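(* Let $\mathcal{F}$ be a finite family of convex sets in $\mathbb{R}^2$, and let $\mathcal{M}$ be a matroid with ground set $\mathcal{F}$, rank $4$ and rank function $r$. If every $4$ sets of $\mathcal{F}$ whose set has rank $4$ in $\mathcal{M}$ can be pierced by a line, then there are $2$ lines whose union intersects every member of some subfamily $\mathcal{F}'\subseteq\mathcal{F}$ with $r(\mathcal{F}\setminus\mathcal{F}')\le 3$.
   Context: A family of sets is pierced by a line if the line intersects every member of the family. The rank function $r$ of a matroid assigns to a subset of the ground set the size of a largest independent set contained in it. *)

theory Defs
  imports "HOL-Analysis.Analysis"
begin

locale matroid =
  fixes E :: "'a set" and indep :: "'a set \<Rightarrow> bool"
  assumes finite_ground: "finite E"
    and indep_subset_ground: "indep X \<Longrightarrow> X \<subseteq> E"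
    and indep_empty: "indep {}"
    and indep_subset: "indep Y \<Longrightarrow> X \<subseteq> Y \<Longrightarrow> indep X"
    and augmentation:
      "indep X \<Longrightarrow> indep Y \<Longrightarrow> card X < card Y \<Longrightarrow> \<exists>y \<in> Y - X. indep (insert y X)"

text \<open>The maximum is over a finite nonempty set, hence meaningful, whenever \<open>X\<close> is finite and
  \<open>indep\<close> is the independence predicate of a matroid.\<close>

definition matroid_rank :: "('a set \<Rightarrow> bool) \<Rightarrow> 'a set \<Rightarrow> nat" where
  "matroid_rank indep X = Max (card ` {I. I \<subseteq> X \<and> indep I})"

definition line :: "'a::euclidean_space set \<Rightarrow> bool" where
  "line L \<longleftrightarrow> affine L \<and> aff_dim L = 1"

definition pierces :: "'a set \<Rightarrow> 'a set set \<Rightarrow> bool" where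
  "pierces L \<F> \<longleftrightarrow> (\<forall>A \<in> \<F>. L \<inter> A \<noteq> {})"

end

theory Submission imports Defs begin

text \<open>Suppose no two lines work. Four consecutive arcs of a large circle, whose lengths are the
  barycentric coordinates of a point \<open>x\<close> of the 3-simplex, determine two chords joining opposite
  division points, and the chords cut the disk into four open quadrants; the \<open>i\<close>-th quadrant is
  empty when \<open>x\<^sub>i = 0\<close>. By assumption, for every \<open>x\<close> the members of the family that avoid both
  chords, each of which lies in a single quadrant, contain a basis. A KKM-type theorem for matroids
  then yields a point \<open>x\<close> and a basis with exactly one member in each quadrant, and no line meets
  all four quadrants.

  For the KKM-type theorem, a weighted average of bases inside the avoiding members depends
  continuously on \<open>x\<close> and lies in the base polytope. Brouwer's theorem gives an \<open>x\<close> at which every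
  quadrant carries total weight 1. At such an \<open>x\<close> the members lying in any \<open>k\<close> of the quadrants
  have rank at least \<open>k\<close>, so Rado's theorem provides the independent transversal.\<close>

section \<open>Brouwer's fixed point theorem on the standard simplex\<close>

definition std_simplex :: "(real ^ 'n) set" where
  "std_simplex = {x. (\<forall>i. 0 \<le> x $ i) \<and> (\<Sum>i\<in>UNIV. x $ i) = 1}"

lemma convex_std_simplex: "convex (std_simplex :: (real ^ 'n) set)"
  by (auto simp: convex_def std_simplex_def sum.distrib simp flip: sum_distrib_left)

lemma compact_std_simplex: "compact (std_simplex :: (real ^ 'n) set)"
proof -
  have "bounded (std_simplex :: (real ^ 'n) set)"
  proof (rule bounded_subset[OF bounded_cbox[of 0 1]], rule subsetI)
    fix x :: "real ^ 'n" assume "x \<in> std_simplex"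
    then have x: "\<And>i. 0 \<le> x $ i" "(\<Sum>i\<in>UNIV. x $ i) = 1" by (auto simp: std_simplex_def)
    have "x $ i \<le> (\<Sum>i\<in>UNIV. x $ i)" for i using x(1) by (intro member_le_sum) auto
    with x show "x \<in> cbox 0 1" by (auto simp: mem_box_cart)
  qed
  moreover have "closed (std_simplex :: (real ^ 'n) set)"
    unfolding std_simplex_def
    by (intro closed_Collect_conj closed_Collect_all closed_Collect_le closed_Collect_eq
        continuous_intros)
  ultimately show ?thesis by (simp add: compact_eq_bounded_closed)
qed

lemma std_simplex_nonempty: "(std_simplex :: (real ^ 'n) set) \<noteq> {}"
proof -
  have "(\<chi> i. 1 / real CARD('n)) \<in> (std_simplex :: (real ^ 'n) set)"
    by (simp add: std_simplex_def)
  then show ?thesis by blast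
qed

text \<open>The normalised map \<open>F\<close> has a fixed point by Brouwer, where
  \<open>x $ i * S x = max 0 (h i x)\<close>. If \<open>S x\<close> were positive, so would be every
  \<open>h i x\<close>: by this equation where \<open>x $ i\<close> is nonzero, by
  \<open>face\<close> elsewhere. That contradicts \<open>total\<close>.\<close>

lemma std_simplex_nonpos_point:
  fixes h :: "'n::finite \<Rightarrow> real ^ 'n \<Rightarrow> real"
  assumes cont: "\<And>i. continuous_on std_simplex (h i)"
    and face: "\<And>i x. x \<in> std_simplex \<Longrightarrow> x $ i = 0 \<Longrightarrow> 0 < h i x"
    and total: "\<And>x. x \<in> std_simplex \<Longrightarrow> (\<Sum>i\<in>UNIV. h i x) \<le> 0"
  obtains x where "x \<in> std_simplex" "\<And>i. h i x \<le> 0"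
proof -
  define S where "S x = (\<Sum>i\<in>UNIV. max 0 (h i x))" for x
  define F :: "real ^ 'n \<Rightarrow> real ^ 'n" where "F x = (\<chi> i. (x $ i + max 0 (h i x)) / (1 + S x))" for x
  have S0: "0 \<le> S x" for x by (auto simp: S_def intro: sum_nonneg)
  have "continuous_on std_simplex F"
    unfolding F_def S_def
    by (intro continuous_intros cont) (use S0 in \<open>auto simp: S_def add_nonneg_eq_0_iff\<close>)
  moreover have "F \<in> std_simplex \<rightarrow> std_simplex"
  proof
    fix x :: "real ^ 'n" assume x: "x \<in> std_simplex"
    have "(\<Sum>i\<in>UNIV. F x $ i) = (\<Sum>i\<in>UNIV. x $ i + max 0 (h i x)) / (1 + S x)"
      by (simp add: F_def sum_divide_distrib)
    also have "\<dots> = 1" using x S0[of x] by (simp add: std_simplex_def sum.distrib S_def)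
    finally show "F x \<in> std_simplex" using x S0[of x] by (auto simp: std_simplex_def F_def)
  qed
  ultimately obtain x where x: "x \<in> std_simplex" "F x = x"
    by (rule brouwer[OF compact_std_simplex convex_std_simplex std_simplex_nonempty])
  have fix_eq: "x $ i * S x = max 0 (h i x)" for i
  proof -
    have "x $ i = (x $ i + max 0 (h i x)) / (1 + S x)" using x(2) by (metis F_def vec_lambda_beta)
    then show ?thesis using S0[of x] by (simp add: field_simps)
  qed
  have "S x = 0"
  proof (rule ccontr)
    assume "S x \<noteq> 0"
    have "0 < h i x" for i
    proof (cases "x $ i = 0")
      case True
      then show ?thesis using face x(1) by blast
    next
      case False
      then show ?thesis using fix_eq[of i] \<open>S x \<noteq> 0\<close> 
        by (cases "h i x = 0") (auto simp: max_def split: if_splits)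
    qed
    then have "0 < (\<Sum>i\<in>UNIV. h i x)" by (intro sum_pos) auto
    then show False using total[OF x(1)] by simp
  qed
  then have "h i x \<le> 0" for i using fix_eq[of i] by (simp add: max_def split: if_splits)
  then show ?thesis using that x(1) by blast
qed

section \<open>Matroid rank, Rado's theorem and the KKM theorem for matroids\<close>

context matroid
begin

lemma finite_indep: "indep X \<Longrightarrow> finite X"
  using finite_ground finite_subset indep_subset_ground by blast

lemma finite_indep_sets: "finite {I. I \<subseteq> X \<and> indep I}"
  by (rule finite_subset[of _ "Pow E"]) (use indep_subset_ground finite_ground in auto)

lemma card_le_rank: "indep I \<Longrightarrow> I \<subseteq> X \<Longrightarrow> card I \<le> matroid_rank indep X"
  unfolding matroid_rank_def using finite_indep_sets by (intro Max_ge) auto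

lemma rank_attained:
  obtains I where "I \<subseteq> X" "indep I" "card I = matroid_rank indep X"
proof -
  have "matroid_rank indep X \<in> card ` {I. I \<subseteq> X \<and> indep I}"
    unfolding matroid_rank_def
    by (intro Max_in finite_imageI finite_indep_sets) (use indep_empty in auto)
  then show ?thesis using that by auto
qed

lemma rank_indep:
  assumes "indep I"
  shows "matroid_rank indep I = card I"
proof (rule antisym)
  obtain J where "J \<subseteq> I" "indep J" "card J = matroid_rank indep I" by (rule rank_attained)
  then show "matroid_rank indep I \<le> card I" using assms finite_indep by (metis card_mono)
  show "card I \<le> matroid_rank indep I" using assms by (simp add: card_le_rank)
qed

lemma indep_extend:
  assumes "indep I" "I \<subseteq> X"
  obtains J where "I \<subseteq> J" "J \<subseteq> X" "indep J" "card J = matroid_rank indep X"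
proof -
  have "\<exists>J. I \<subseteq> J \<and> J \<subseteq> X \<and> indep J \<and> card J = matroid_rank indep X"
    using assms
  proof (induction "matroid_rank indep X - card I" arbitrary: I)
    case 0
    then show ?case using card_le_rank[of I X] by auto
  next
    case (Suc k)
    obtain K where K: "K \<subseteq> X" "indep K" "card K = matroid_rank indep X" by (rule rank_attained)
    moreover have "card I < card K" using Suc.hyps(2) K(3) by linarith
    ultimately obtain y where y: "y \<in> K - I" "indep (insert y I)"
      using augmentation[of I K] Suc.prems by blast
    have "k = matroid_rank indep X - card (insert y I)"
      using Suc.hyps(2) Suc.prems y finite_indep[of I] by simp
    from Suc.hyps(1)[OF this y(2)] show ?case using y K Suc.prems by auto
  qed
  then show ?thesis using that by blast
qed

text \<open>A basis of \<open>X \<inter> Y\<close> is extended to one of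
  \<open>X \<union> Y\<close>; its traces on \<open>X\<close> and \<open>Y\<close> are independent,
  and their sizes sum to at least the left side.\<close>

lemma rank_submodular:
  "matroid_rank indep (X \<union> Y) + matroid_rank indep (X \<inter> Y)
    \<le> matroid_rank indep X + matroid_rank indep Y"
proof -
  obtain I where I: "I \<subseteq> X \<inter> Y" "indep I" "card I = matroid_rank indep (X \<inter> Y)"
    by (rule rank_attained)
  obtain J where J: "I \<subseteq> J" "J \<subseteq> X \<union> Y" "indep J" "card J = matroid_rank indep (X \<union> Y)"
    using indep_extend[OF I(2), of "X \<union> Y"] I(1) by blast
  have fin: "finite J" using J finite_indep by blast
  have "card (J \<inter> X) + card (J \<inter> Y) = card ((J \<inter> X) \<union> (J \<inter> Y)) + card ((J \<inter> X) \<inter> (J \<inter> Y))"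
    using fin by (intro card_Un_Int) auto
  moreover have "(J \<inter> X) \<union> (J \<inter> Y) = J" using J(2) by auto
  moreover have "card I \<le> card ((J \<inter> X) \<inter> (J \<inter> Y))"
    using fin I(1) J(1) by (intro card_mono) auto
  moreover have "card (J \<inter> X) \<le> matroid_rank indep X" "card (J \<inter> Y) \<le> matroid_rank indep Y"
    using J(3) indep_subset by (auto intro!: card_le_rank)
  ultimately show ?thesis using I(3) J(4) by simp
qed

lemma rank_mono: "X \<subseteq> Y \<Longrightarrow> matroid_rank indep X \<le> matroid_rank indep Y"
  by (metis card_le_rank order_trans rank_attained)

text \<open>Elements are deleted from the sets one by one while the rank condition persists, until
  all sets are singletons. By submodularity, of two elements of one set at least one can be
  deleted.\<close>

theorem rado_transversal:
  assumes "finite I" "\<And>i. i \<in> I \<Longrightarrow> A i \<subseteq> E"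
    and "\<And>J. J \<subseteq> I \<Longrightarrow> card J \<le> matroid_rank indep (\<Union>(A ` J))"
  shows "\<exists>f. inj_on f I \<and> indep (f ` I) \<and> (\<forall>i\<in>I. f i \<in> A i)"
  using assms(2,3)
proof (induction "\<Sum>i\<in>I. card (A i)" arbitrary: A rule: less_induct)
  case less
  note sub = less.prems(1) and rado = less.prems(2)
  have fin: "finite (A i)" if "i \<in> I" for i
    using sub[OF that] finite_ground finite_subset by blast
  have ne: "A i \<noteq> {}" if "i \<in> I" for i
  proof
    assume "A i = {}"
    then show False using rado[of "{i}"] that rank_indep[OF indep_empty] by simp
  qed
  show ?case
  proof (cases "\<exists>i\<in>I. \<exists>x\<in>A i. \<exists>y\<in>A i. x \<noteq> y")
    case False
    then have "\<forall>i\<in>I. \<exists>x. A i = {x}" using ne by (metis is_singletonI' is_singletonE)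
    then obtain f where f: "\<And>i. i \<in> I \<Longrightarrow> A i = {f i}" by metis
    have un: "\<Union>(A ` I) = f ` I" using f by auto
    obtain B where B: "B \<subseteq> f ` I" "indep B" "card B = matroid_rank indep (f ` I)"
      by (rule rank_attained)
    \<comment> \<open>The condition for all of \<open>I\<close> leaves no slack: the representatives
      are distinct and independent.\<close>
    have "card I \<le> card B" using rado[of I] un B by simp
    moreover have "card (f ` I) \<le> card I" using assms(1) by (rule card_image_le)
    ultimately have "B = f ` I" "card (f ` I) = card I"
      using B(1) assms(1) card_mono[of "f ` I" B] card_seteq[of "f ` I" B] by auto
    then show ?thesis using B(2) f assms(1) eq_card_imp_inj_on by blast
  next
    case True
    then obtain k x y where k: "k \<in> I" and x: "x \<in> A k" and y: "y \<in> A k" and "x \<noteq> y" by blast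
    \<comment> \<open>Either deleting \<open>z\<close> preserves the condition and the induction
      hypothesis applies, or some index set violates it. That set contains \<open>k\<close>, and
      \<open>J\<close> is the rest of it, so the strict violation becomes
      \<open>\<le> card J\<close>.\<close>
    have *: "(\<exists>f. inj_on f I \<and> indep (f ` I) \<and> (\<forall>i\<in>I. f i \<in> A i)) \<or>
        (\<exists>J. J \<subseteq> I - {k} \<and> matroid_rank indep ((A k - {z}) \<union> \<Union>(A ` J)) \<le> card J)"
      if z: "z \<in> A k" for z
    proof -
      let ?A = "A(k := A k - {z})"
      have lt: "(\<Sum>i\<in>I. card (?A i)) < (\<Sum>i\<in>I. card (A i))"
      proof (rule sum_strict_mono_ex1)
        show "\<forall>i\<in>I. card (?A i) \<le> card (A i)" using fin by (auto intro: card_mono)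
        show "\<exists>i\<in>I. card (?A i) < card (A i)"
          using k card_Diff1_less[OF fin[OF k] z] by (intro bexI[of _ k]) auto
      qed (use assms(1) in auto)
      show ?thesis
      proof (cases "\<forall>J\<subseteq>I. card J \<le> matroid_rank indep (\<Union>(?A ` J))")
        case True
        have "\<And>i. i \<in> I \<Longrightarrow> ?A i \<subseteq> E" using sub by auto
        from less.hyps[OF lt this] True obtain f where
          "inj_on f I" "indep (f ` I)" "\<forall>i\<in>I. f i \<in> ?A i" by blast
        then show ?thesis by (metis Diff_iff fun_upd_apply)
      next
        case False
        then obtain J where J: "J \<subseteq> I" "matroid_rank indep (\<Union>(?A ` J)) < card J"
          by (auto simp: not_le)
        have "k \<in> J"
        proof (rule ccontr)
          assume "k \<notin> J"
          then have "\<Union>(?A ` J) = \<Union>(A ` J)" by (auto split: if_splits)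
          then show False using J rado[of J] by simp
        qed
        then have "\<Union>(?A ` J) = (A k - {z}) \<union> \<Union>(A ` (J - {k}))" by (auto split: if_splits)
        moreover have "card J = Suc (card (J - {k}))"
          using \<open>k \<in> J\<close> J(1) assms(1) by (metis card_Suc_Diff1 finite_subset)
        ultimately show ?thesis using J by (intro disjI2 exI[of _ "J - {k}"]) auto
      qed
    qed
    show ?thesis
    proof (rule ccontr)
      assume no: "\<not> ?thesis"
      obtain J\<^sub>1 where J1: "J\<^sub>1 \<subseteq> I - {k}" "matroid_rank indep ((A k - {x}) \<union> \<Union>(A ` J\<^sub>1)) \<le> card J\<^sub>1"
        using *[OF x] no by blast
      obtain J\<^sub>2 where J2: "J\<^sub>2 \<subseteq> I - {k}" "matroid_rank indep ((A k - {y}) \<union> \<Union>(A ` J\<^sub>2)) \<le> card J\<^sub>2"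
        using *[OF y] no by blast
      let ?X = "(A k - {x}) \<union> \<Union>(A ` J\<^sub>1)" and ?Y = "(A k - {y}) \<union> \<Union>(A ` J\<^sub>2)"
      have "insert k (J\<^sub>1 \<union> J\<^sub>2) \<subseteq> I" "J\<^sub>1 \<inter> J\<^sub>2 \<subseteq> I" using J1(1) J2(1) k by auto
      note rado' = this[THEN rado]
      \<comment> \<open>As \<open>x\<close> and \<open>y\<close> differ,
        \<open>?X \<union> ?Y\<close> contains all of \<open>A k\<close>; the index \<open>k\<close>
        then adds the 1 that refutes submodularity.\<close>
      have "card (insert k (J\<^sub>1 \<union> J\<^sub>2)) \<le> matroid_rank indep (?X \<union> ?Y)"
        by (rule order_trans[OF rado'(1) rank_mono]) (use \<open>x \<noteq> y\<close> in auto)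
      moreover have "card (J\<^sub>1 \<inter> J\<^sub>2) \<le> matroid_rank indep (?X \<inter> ?Y)"
        by (rule order_trans[OF rado'(2) rank_mono]) auto
      moreover have fJ: "finite J\<^sub>1" "finite J\<^sub>2"
        using J1(1) J2(1) assms(1) by (auto intro: finite_subset)
      then have "card (insert k (J\<^sub>1 \<union> J\<^sub>2)) = Suc (card (J\<^sub>1 \<union> J\<^sub>2))"
        using J1(1) J2(1) by (intro card_insert_disjoint) auto
      ultimately show False
        using rank_submodular[of ?X ?Y] card_Un_Int[OF fJ] J1(2) J2(2) by linarith
    qed
  qed
qed

text \<open>\<open>w i a x\<close> is the weight of colour \<open>i\<close> on \<open>a\<close> at
  \<open>x\<close>; an element may carry several colours. \<open>face\<close> speaks of non-loops
  because the product weights in the application equal 1 on loops, which lie in no basis.\<close>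

theorem matroid_kkm:
  fixes w :: "'n::finite \<Rightarrow> 'a \<Rightarrow> real ^ 'n \<Rightarrow> real"
  assumes cont: "\<And>i a. a \<in> E \<Longrightarrow> continuous_on std_simplex (w i a)"
    and nonneg: "\<And>i a x. x \<in> std_simplex \<Longrightarrow> a \<in> E \<Longrightarrow> 0 \<le> w i a x"
    and face: "\<And>i a x. x \<in> std_simplex \<Longrightarrow> x $ i = 0 \<Longrightarrow> indep {a} \<Longrightarrow> w i a x = 0"
    and cover: "\<And>x. x \<in> std_simplex \<Longrightarrow>
      \<exists>B. indep B \<and> card B = CARD('n) \<and> (\<forall>a\<in>B. \<exists>i. 0 < w i a x)"
  obtains x f where "x \<in> std_simplex" "inj f" "indep (range f)" "\<And>i. 0 < w i (f i) x"
proof -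
  define \<B> where "\<B> = {B. indep B \<and> card B = CARD('n)}"
  \<comment> \<open>\<open>G i x / T x\<close> is the weight carried by colour \<open>i\<close> in the average of the bases \<open>B\<close> with weights
    proportional to \<open>\<Prod>a\<in>B. W a x\<close>; cancelling the denominators keeps it continuous.\<close>
  define W where "W a x = (\<Sum>i\<in>UNIV. w i a x)" for a x
  define T where "T x = (\<Sum>B\<in>\<B>. \<Prod>a\<in>B. W a x)" for x
  define G where "G i x = (\<Sum>B\<in>\<B>. \<Sum>a\<in>B. w i a x * (\<Prod>b\<in>B - {a}. W b x))" for i x
  have BE: "a \<in> E" if "B \<in> \<B>" "a \<in> B" for a B using that indep_subset_ground by (auto simp: \<B>_def)
  have finB: "finite B" if "B \<in> \<B>" for B using that finite_indep by (auto simp: \<B>_def)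
  have fin\<B>: "finite \<B>"
    by (rule finite_subset[OF _ finite_indep_sets[of E]]) (use indep_subset_ground in \<open>auto simp: \<B>_def\<close>)
  have W0: "0 \<le> W a x" if "x \<in> std_simplex" "a \<in> E" for a x
    using that nonneg by (auto simp: W_def intro!: sum_nonneg)
  have prod0: "0 \<le> (\<Prod>a\<in>B'. W a x)" if "x \<in> std_simplex" "B \<in> \<B>" "B' \<subseteq> B" for B B' x
    using that W0 BE by (intro prod_nonneg) blast
  have Tpos: "0 < T x" if x: "x \<in> std_simplex" for x
  proof -
    obtain B where B: "B \<in> \<B>" "\<forall>a\<in>B. \<exists>i. 0 < w i a x" using cover[OF x] by (auto simp: \<B>_def)
    have "0 < W a x" if a: "a \<in> B" for a
    proof -
      obtain i where "0 < w i a x" using B a by blast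
      moreover have "w i a x \<le> W a x"
        unfolding W_def using nonneg[OF x] BE[OF B(1) a] by (intro member_le_sum) auto
      ultimately show ?thesis by simp
    qed
    then have "0 < (\<Prod>a\<in>B. W a x)" by (rule prod_pos)
    also have "\<dots> \<le> T x"
      unfolding T_def using B(1) fin\<B> prod0[OF x] by (intro member_le_sum) auto
    finally show ?thesis .
  qed
  have G_sum: "(\<Sum>i\<in>J. G i x) = (\<Sum>B\<in>\<B>. \<Sum>a\<in>B. (\<Sum>i\<in>J. w i a x) * (\<Prod>b\<in>B - {a}. W b x))" for J x
  proof -
    have "(\<Sum>i\<in>J. G i x) = (\<Sum>B\<in>\<B>. \<Sum>i\<in>J. \<Sum>a\<in>B. w i a x * (\<Prod>b\<in>B - {a}. W b x))"
      unfolding G_def by (rule sum.swap)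
    also have "\<dots> = (\<Sum>B\<in>\<B>. \<Sum>a\<in>B. \<Sum>i\<in>J. w i a x * (\<Prod>b\<in>B - {a}. W b x))"
      by (intro sum.cong refl sum.swap)
    finally show ?thesis by (simp add: sum_distrib_right)
  qed
  have prod_split: "W a x * (\<Prod>b\<in>B - {a}. W b x) = (\<Prod>b\<in>B. W b x)" if "B \<in> \<B>" "a \<in> B" for a B x
    using that finB by (simp add: prod.remove)
  have G_total: "(\<Sum>i\<in>UNIV. G i x) = real CARD('n) * T x" for x
  proof -
    have "(\<Sum>i\<in>UNIV. G i x) = (\<Sum>B\<in>\<B>. \<Sum>a\<in>B. \<Prod>b\<in>B. W b x)"
      unfolding G_sum by (intro sum.cong refl) (simp add: prod_split flip: W_def)
    also have "\<dots> = (\<Sum>B\<in>\<B>. real CARD('n) * (\<Prod>b\<in>B. W b x))"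
      by (intro sum.cong refl) (simp add: \<B>_def)
    finally show ?thesis by (simp add: T_def sum_distrib_left)
  qed
  \<comment> \<open>The colour weights \<open>G i x / T x\<close> add up to \<open>CARD('n)\<close>
    by \<open>G_total\<close>; at the point found, each is at least 1.\<close>
  obtain x where x: "x \<in> std_simplex" and TG: "\<And>i. T x - G i x \<le> 0"
  proof (rule std_simplex_nonpos_point[of "\<lambda>i x. T x - G i x"])
    have contW: "continuous_on std_simplex (W a)" if "a \<in> E" for a
      unfolding W_def using that cont by (intro continuous_intros)
    show "continuous_on std_simplex (\<lambda>x. T x - G i x)" for i
      unfolding T_def G_def by (intro continuous_intros contW cont) (auto intro: BE)
    show "0 < T x - G i x" if "x \<in> std_simplex" "x $ i = 0" for i x
    proof -
      have "w i a x = 0" if "B \<in> \<B>" "a \<in> B" for a B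
        using that \<open>x \<in> std_simplex\<close> \<open>x $ i = 0\<close>
        by (intro face) (auto simp: \<B>_def intro: indep_subset)
      then have "G i x = 0" by (simp add: G_def)
      then show ?thesis using Tpos that by simp
    qed
    show "(\<Sum>i\<in>UNIV. T x - G i x) \<le> 0" for x
      by (simp add: sum_subtractf G_total)
  qed (use that in blast)
  define A where "A i = {a \<in> E. 0 < w i a x}" for i
  have "\<exists>f. inj_on f UNIV \<and> indep (f ` UNIV) \<and> (\<forall>i\<in>UNIV. f i \<in> A i)"
  proof (rule rado_transversal)
    fix J :: "'n set"
    let ?U = "\<Union>(A ` J)"
    \<comment> \<open>The colours in \<open>J\<close> carry weight at least \<open>card J\<close>.
      In a basis \<open>B\<close> only elements of \<open>?U\<close> have such a colour, and
      \<open>B \<inter> ?U\<close> is independent, so \<open>B\<close> contributes at most the rank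
      of \<open>?U\<close> times its product.\<close>
    have "real (card J) * T x = (\<Sum>i\<in>J. T x)" by simp
    also have "\<dots> \<le> (\<Sum>i\<in>J. G i x)" using TG by (intro sum_mono) simp
    also have "\<dots> \<le> (\<Sum>B\<in>\<B>. real (matroid_rank indep ?U) * (\<Prod>b\<in>B. W b x))"
      unfolding G_sum
    proof (rule sum_mono)
      fix B assume B: "B \<in> \<B>"
      have "(\<Sum>a\<in>B. (\<Sum>i\<in>J. w i a x) * (\<Prod>b\<in>B - {a}. W b x))
          \<le> (\<Sum>a\<in>B. if a \<in> ?U then \<Prod>b\<in>B. W b x else 0)"
      proof (rule sum_mono)
        fix a assume a: "a \<in> B"
        have aE: "a \<in> E" using BE B a by blast
        show "(\<Sum>i\<in>J. w i a x) * (\<Prod>b\<in>B - {a}. W b x) \<le> (if a \<in> ?U then \<Prod>b\<in>B. W b x else 0)"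
        proof (cases "a \<in> ?U")
          case True
          have "(\<Sum>i\<in>J. w i a x) \<le> W a x"
            unfolding W_def using nonneg[OF x aE] by (intro sum_mono2) auto
          then have "(\<Sum>i\<in>J. w i a x) * (\<Prod>b\<in>B - {a}. W b x) \<le> W a x * (\<Prod>b\<in>B - {a}. W b x)"
            using prod0[OF x B] by (intro mult_right_mono) auto
          then show ?thesis using True prod_split[OF B a] by simp
        next
          case False
          then have "w i a x = 0" if "i \<in> J" for i
            using that nonneg[OF x aE, of i] aE by (force simp: A_def)
          then show ?thesis using False by simp
        qed
      qed
      also have "\<dots> = real (card (B \<inter> ?U)) * (\<Prod>b\<in>B. W b x)"
        using finB[OF B] by (simp add: sum.inter_restrict[symmetric] del: Union_iff UN_iff)
      also have "\<dots> \<le> real (matroid_rank indep ?U) * (\<Prod>b\<in>B. W b x)"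
      proof (intro mult_right_mono prod0[OF x B] of_nat_mono card_le_rank)
        show "indep (B \<inter> ?U)" using B indep_subset by (auto simp: \<B>_def)
      qed auto
      finally show "(\<Sum>a\<in>B. (\<Sum>i\<in>J. w i a x) * (\<Prod>b\<in>B - {a}. W b x))
          \<le> real (matroid_rank indep ?U) * (\<Prod>b\<in>B. W b x)" .
    qed
    also have "\<dots> = real (matroid_rank indep ?U) * T x" by (simp add: T_def sum_distrib_left)
    finally show "card J \<le> matroid_rank indep ?U" using Tpos[OF x] by simp
  qed (auto simp: A_def)
  then show ?thesis using that x by (auto simp: A_def)
qed

end

section \<open>Geometry of chords, quadrants, lines and convex sets\<close>

text \<open>The sign tells on which side of the chord with endpoints at angles \<open>a\<close> and \<open>b\<close> of the circle of
  radius \<open>\<rho>\<close> the point \<open>(u, v)\<close> lies; it is positive towards the arc from \<open>a\<close> to \<open>b\<close>. For \<open>a = b\<close> and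
  \<open>b = a + 2\<pi>\<close> the chord becomes the tangent, so degenerate arcs need no special treatment.\<close>

definition arc_side :: "real \<Rightarrow> real \<Rightarrow> real \<Rightarrow> real \<Rightarrow> real \<Rightarrow> real" where
  "arc_side \<rho> a b u v = u * cos ((a + b) / 2) + v * sin ((a + b) / 2) - \<rho> * cos ((b - a) / 2)"

text \<open>The complementary arc has the same chord, seen from the other side.\<close>

lemma arc_side_complement: "arc_side \<rho> b (a + 2 * pi) u v = - arc_side \<rho> a b u v"
proof -
  have "(b + (a + 2 * pi)) / 2 = (a + b) / 2 + pi" "(a + 2 * pi - b) / 2 = pi - (b - a) / 2"
    by (simp_all add: field_simps)
  then show ?thesis unfolding arc_side_def by (simp only: cos_add sin_add cos_diff) simp
qed

lemma arc_side_reflect: "arc_side \<rho> (- b) (- a) u (- v) = arc_side \<rho> a b u v"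
proof -
  have "(- b + - a) / 2 = - ((a + b) / 2)" "(- a - - b) / 2 = (b - a) / 2"
    by (simp_all add: field_simps)
  then show ?thesis unfolding arc_side_def by (simp only: cos_minus sin_minus minus_mult_minus)
qed

text \<open>With \<open>a\<close> fixed, the side function is
  \<open>\<alpha> * cos t + \<beta> * sin t\<close> in the half length \<open>t\<close> of the arc,
  and \<open>\<alpha>\<close> is negative inside the disk. Such a function starts negative and, once
  positive, stays so up to \<open>pi\<close>: caps grow with their arcs.\<close>

lemma arc_side_mono_right:
  assumes "u\<^sup>2 + v\<^sup>2 < \<rho>\<^sup>2" "0 \<le> \<rho>" "a \<le> b" "b \<le> b'" "b' \<le> a + 2 * pi" "0 < arc_side \<rho> a b u v"
  shows "0 < arc_side \<rho> a b' u v"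
proof -
  define \<alpha> \<beta> where "\<alpha> = u * cos a + v * sin a - \<rho>" and "\<beta> = v * cos a - u * sin a"
  have expand: "arc_side \<rho> a c u v = \<alpha> * cos ((c - a) / 2) + \<beta> * sin ((c - a) / 2)" for c
  proof -
    have "(a + c) / 2 = a + (c - a) / 2" by (simp add: field_simps)
    then show ?thesis
      unfolding arc_side_def \<alpha>_def \<beta>_def by (simp only: cos_add sin_add) (simp add: algebra_simps)
  qed
  have "(u * cos a + v * sin a)\<^sup>2 \<le> (u * cos a + v * sin a)\<^sup>2 + (v * cos a - u * sin a)\<^sup>2"
    by (rule le_add_same_cancel1[THEN iffD2]) (rule zero_le_power2)
  also have "\<dots> = (u\<^sup>2 + v\<^sup>2) * ((sin a)\<^sup>2 + (cos a)\<^sup>2)" by algebra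
  also have "\<dots> < \<rho>\<^sup>2" using assms(1) by simp
  finally have "(u * cos a + v * sin a)\<^sup>2 < \<rho>\<^sup>2" .
  then have \<alpha>: "\<alpha> < 0" using assms(2) by (auto simp: \<alpha>_def dest: power2_less_imp_less)
  define t t' where "t = (b - a) / 2" and "t' = (b' - a) / 2"
  have t: "0 \<le> t" "t \<le> t'" "t' \<le> pi" using assms by (auto simp: t_def t'_def)
  have pos: "0 < \<alpha> * cos t + \<beta> * sin t" using assms(6) by (simp add: expand t_def)
  have "0 < \<alpha> * cos t' + \<beta> * sin t'"
  proof (cases "t = t'")
    case False
    have "t \<noteq> 0" using pos \<alpha> by auto
    then have st: "0 < sin t" using t False by (intro sin_gt_zero) auto
    have d: "0 < sin (t' - t)" using t False \<open>t \<noteq> 0\<close> by (intro sin_gt_zero) auto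
    have st': "0 \<le> sin t'" using t by (intro sin_ge_zero) auto
    \<comment> \<open>The factors \<open>sin t\<close> and \<open>sin t'\<close> make the
      \<open>\<beta>\<close> terms cancel.\<close>
    have "sin t * (\<alpha> * cos t' + \<beta> * sin t') = sin t' * (\<alpha> * cos t + \<beta> * sin t) + (- \<alpha>) * sin (t' - t)"
      by (simp add: sin_diff algebra_simps)
    also have "\<dots> > 0" using st' pos \<alpha> d by (intro add_nonneg_pos mult_nonneg_nonneg mult_pos_pos) auto
    finally show ?thesis using st by (simp add: zero_less_mult_iff)
  qed (use pos in simp)
  then show ?thesis by (simp add: expand t'_def)
qed

lemma arc_side_mono_left:
  assumes "u\<^sup>2 + v\<^sup>2 < \<rho>\<^sup>2" "0 \<le> \<rho>" "a' \<le> a" "a \<le> b" "b \<le> a' + 2 * pi" "0 < arc_side \<rho> a b u v"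
  shows "0 < arc_side \<rho> a' b u v"
  using arc_side_mono_right[of u "- v" \<rho> "- b" "- a" "- a'"] assms by (simp add: arc_side_reflect)

text \<open>The division points are at the angles \<open>0\<close>, \<open>2\<pi>x\<^sub>1\<close>, \<open>2\<pi>(x\<^sub>1 + x\<^sub>2)\<close>, \<open>2\<pi>(x\<^sub>1 + x\<^sub>2 + x\<^sub>3)\<close>.\<close>

definition chord_side\<^sub>1 :: "real \<Rightarrow> real ^ 4 \<Rightarrow> real ^ 2 \<Rightarrow> real" where
  "chord_side\<^sub>1 \<rho> x p = arc_side \<rho> 0 (2 * pi * (x $ 1 + x $ 2)) (p $ 1) (p $ 2)"

definition chord_side\<^sub>2 :: "real \<Rightarrow> real ^ 4 \<Rightarrow> real ^ 2 \<Rightarrow> real" where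
  "chord_side\<^sub>2 \<rho> x p =
    arc_side \<rho> (2 * pi * x $ 1) (2 * pi * (x $ 1 + x $ 2 + x $ 3)) (p $ 1) (p $ 2)"

text \<open>Quadrant \<open>i\<close> faces the \<open>i\<close>-th arc: the first chord separates
  arcs 1, 2 from 3, 4, the second arcs 2, 3 from 4, 1. The minimum turns membership into positivity
  of a continuous function.\<close>

definition quadrant_depth :: "real \<Rightarrow> 4 \<Rightarrow> real ^ 4 \<Rightarrow> real ^ 2 \<Rightarrow> real" where
  "quadrant_depth \<rho> i x p =
    min ((if i \<in> {1, 2} then 1 else - 1) * chord_side\<^sub>1 \<rho> x p)
        ((if i \<in> {2, 3} then 1 else - 1) * chord_side\<^sub>2 \<rho> x p)"

lemma continuous_on_quadrant_depth: "continuous_on S (\<lambda>x. quadrant_depth \<rho> i x p)"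
  unfolding quadrant_depth_def chord_side\<^sub>1_def chord_side\<^sub>2_def arc_side_def
  by (intro continuous_intros) auto

lemma quadrant_depth_pos_iff:
  "0 < quadrant_depth \<rho> 1 x p \<longleftrightarrow> 0 < chord_side\<^sub>1 \<rho> x p \<and> chord_side\<^sub>2 \<rho> x p < 0"
  "0 < quadrant_depth \<rho> 2 x p \<longleftrightarrow> 0 < chord_side\<^sub>1 \<rho> x p \<and> 0 < chord_side\<^sub>2 \<rho> x p"
  "0 < quadrant_depth \<rho> 3 x p \<longleftrightarrow> chord_side\<^sub>1 \<rho> x p < 0 \<and> 0 < chord_side\<^sub>2 \<rho> x p"
  "0 < quadrant_depth \<rho> 4 x p \<longleftrightarrow> chord_side\<^sub>1 \<rho> x p < 0 \<and> chord_side\<^sub>2 \<rho> x p < 0"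
  by (simp_all add: quadrant_depth_def)

text \<open>When the \<open>i\<close>-th arc vanishes, the two chords share an endpoint. Their caps
  are then nested, disjoint, or leave no point strictly outside both, and the quadrant is
  empty.\<close>

lemma quadrant_depth_face:
  assumes x: "x \<in> std_simplex" "x $ i = 0" and p: "norm p < \<rho>"
  shows "quadrant_depth \<rho> i x p \<le> 0"
proof (rule ccontr)
  assume "\<not> ?thesis"
  then have pos: "0 < quadrant_depth \<rho> i x p" by simp
  define b\<^sub>1 a\<^sub>2 b\<^sub>2 where "b\<^sub>1 = 2 * pi * (x $ 1 + x $ 2)" and "a\<^sub>2 = 2 * pi * x $ 1"
    and "b\<^sub>2 = 2 * pi * (x $ 1 + x $ 2 + x $ 3)"
  have nn: "0 \<le> x $ j" for j using x by (simp add: std_simplex_def)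
  have one: "x $ 1 + x $ 2 + x $ 3 + x $ 4 = 1" using x by (simp add: std_simplex_def sum_4)
  have ord: "0 \<le> a\<^sub>2" "a\<^sub>2 \<le> b\<^sub>1" "b\<^sub>1 \<le> b\<^sub>2" "b\<^sub>2 \<le> 2 * pi"
    using nn[of 1] nn[of 2] nn[of 3] nn[of 4] one by (simp_all add: a\<^sub>2_def b\<^sub>1_def b\<^sub>2_def)
  have \<rho>: "0 \<le> \<rho>" using p norm_ge_zero[of p] by linarith
  have "(norm p)\<^sup>2 < \<rho>\<^sup>2" using p by (intro power_strict_mono) auto
  then have disk: "(p $ 1)\<^sup>2 + (p $ 2)\<^sup>2 < \<rho>\<^sup>2"
    by (simp add: norm_vec_def L2_set_def sum_2)
  let ?s = "\<lambda>a b. arc_side \<rho> a b (p $ 1) (p $ 2)"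
  have sides: "chord_side\<^sub>1 \<rho> x p = ?s 0 b\<^sub>1" "chord_side\<^sub>2 \<rho> x p = ?s a\<^sub>2 b\<^sub>2"
    by (simp_all add: chord_side\<^sub>1_def chord_side\<^sub>2_def a\<^sub>2_def b\<^sub>1_def b\<^sub>2_def)
  consider "i = 1" | "i = 2" | "i = 3" | "i = 4" using exhaust_4 by blast
  then show False
  proof cases
    case 1
    then have "a\<^sub>2 = 0" using x by (simp add: a\<^sub>2_def)
    then show False
      using pos 1 arc_side_mono_right[OF disk \<rho>, of 0 b\<^sub>1 b\<^sub>2] ord
      by (simp add: quadrant_depth_pos_iff sides)
  next
    case 2
    then have "a\<^sub>2 = b\<^sub>1" using x by (simp add: a\<^sub>2_def b\<^sub>1_def)
    \<comment> \<open>The second arc grows to the full complement of the first, so a point of the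
      second cap is outside the first.\<close>
    then show False
      using pos 2 arc_side_mono_right[OF disk \<rho>, of b\<^sub>1 b\<^sub>2 "0 + 2 * pi"] ord
      unfolding arc_side_complement by (simp add: quadrant_depth_pos_iff sides)
  next
    case 3
    then have "b\<^sub>2 = b\<^sub>1" using x by (simp add: b\<^sub>1_def b\<^sub>2_def)
    then show False
      using pos 3 arc_side_mono_left[OF disk \<rho>, of 0 a\<^sub>2 b\<^sub>1] ord
      by (simp add: quadrant_depth_pos_iff sides)
  next
    case 4
    then have "b\<^sub>2 = 2 * pi" using x one by (simp add: b\<^sub>2_def)
    \<comment> \<open>A point outside the first cap lies in the cap from \<open>b\<^sub>1\<close> to
      \<open>2 * pi\<close>, which the second cap contains.\<close>
    then show False
      using pos 4 arc_side_mono_left[OF disk \<rho>, of a\<^sub>2 b\<^sub>1 "0 + 2 * pi"] ord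
        arc_side_complement[of \<rho> b\<^sub>1 0 "p $ 1" "p $ 2"]
      by (simp add: quadrant_depth_pos_iff sides)
  qed
qed

text \<open>Along a line each functional is monotone and changes sign at most once, so at most three
  of the four sign patterns occur.\<close>

lemma no_line_through_four_quadrants:
  fixes L :: "'a::euclidean_space set"
  assumes "line L" "q\<^sub>1 \<in> L" "q\<^sub>2 \<in> L" "q\<^sub>3 \<in> L" "q\<^sub>4 \<in> L"
    and "d < c \<bullet> q\<^sub>1" "e \<bullet> q\<^sub>1 < f" "d < c \<bullet> q\<^sub>2" "f < e \<bullet> q\<^sub>2"
    and "c \<bullet> q\<^sub>3 < d" "f < e \<bullet> q\<^sub>3" "c \<bullet> q\<^sub>4 < d" "e \<bullet> q\<^sub>4 < f"
  shows False
proof -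
  have "collinear L" using assms(1) by (simp add: line_def collinear_aff_dim)
  then obtain v where v: "\<And>x y. x \<in> L \<Longrightarrow> y \<in> L \<Longrightarrow> \<exists>k. x - y = k *\<^sub>R v"
    unfolding collinear_def by blast
  have "\<exists>k. x = q\<^sub>1 + k *\<^sub>R v" if "x \<in> L" for x
    using v[OF that assms(2)] by (metis add_diff_cancel_left' diff_add_cancel add.commute)
  then obtain k\<^sub>2 k\<^sub>3 k\<^sub>4 where q: "q\<^sub>2 = q\<^sub>1 + k\<^sub>2 *\<^sub>R v" "q\<^sub>3 = q\<^sub>1 + k\<^sub>3 *\<^sub>R v" "q\<^sub>4 = q\<^sub>1 + k\<^sub>4 *\<^sub>R v"
    using assms(3-5) by metis
  define \<gamma> \<epsilon> where "\<gamma> = c \<bullet> v" and "\<epsilon> = e \<bullet> v"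
  \<comment> \<open>The first row orders the parameters by \<open>c\<close>, the second by
    \<open>e\<close>; for every pair of signs of \<open>\<gamma>\<close> and
    \<open>\<epsilon>\<close> the two orders conflict.\<close>
  have diffs: "k\<^sub>3 * \<gamma> < 0" "k\<^sub>4 * \<gamma> < 0" "k\<^sub>3 * \<gamma> < k\<^sub>2 * \<gamma>" "k\<^sub>4 * \<gamma> < k\<^sub>2 * \<gamma>"
    "0 < k\<^sub>2 * \<epsilon>" "0 < k\<^sub>3 * \<epsilon>" "k\<^sub>4 * \<epsilon> < k\<^sub>2 * \<epsilon>" "k\<^sub>4 * \<epsilon> < k\<^sub>3 * \<epsilon>"
    using assms(6-13) unfolding q inner_add_right inner_scaleR_right \<gamma>_def \<epsilon>_def by linarith+
  show False
    using diffs by (cases "0 < \<gamma>"; cases "0 < \<epsilon>")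
      (auto simp: mult_less_0_iff zero_less_mult_iff mult_less_cancel_right not_less)
qed

lemma line_hyperplane:
  fixes c :: "real ^ 2"
  assumes "c \<noteq> 0"
  shows "line {z. c \<bullet> z = d}"
  using assms by (simp add: line_def affine_hyperplane)

lemma other_line:
  fixes L :: "(real ^ 2) set"
  obtains L' where "line L'" "L' \<noteq> L"
proof -
  define c :: "real ^ 2" where "c = axis 1 1"
  have c: "c \<noteq> 0" "c \<bullet> c = 1" by (auto simp: c_def axis_eq_0_iff inner_axis_axis)
  have "c \<in> {z. c \<bullet> z = 1}" "c \<notin> {z. c \<bullet> z = 0}" using c by auto
  then have "{z. c \<bullet> z = 1} \<noteq> {z. c \<bullet> z = 0}" by blast
  then show ?thesis using that line_hyperplane[OF c(1)] by metis
qed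

text \<open>The normal \<open>(cos m, sin m)\<close> is a unit vector whatever the endpoints, so the
  zero set is a line even when the arc is degenerate.\<close>

lemma arc_side_affine:
  "\<exists>c d. c \<noteq> 0 \<and> (\<forall>p :: real ^ 2. arc_side \<rho> a b (p $ 1) (p $ 2) = c \<bullet> p - d)"
proof -
  define m where "m = (a + b) / 2"
  define c :: "real ^ 2" where "c = vector [cos m, sin m]"
  have "c \<noteq> 0"
  proof
    assume "c = 0"
    then have "cos m = 0" "sin m = 0" unfolding c_def by (metis vector_2 zero_index)+
    then show False using sin_cos_squared_add[of m] by simp
  qed
  moreover have "arc_side \<rho> a b (p $ 1) (p $ 2) = c \<bullet> p - \<rho> * cos ((b - a) / 2)" for p :: "real ^ 2"
    by (simp add: arc_side_def c_def m_def inner_vec_def sum_2 mult.commute)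
  ultimately show ?thesis by blast
qed

text \<open>A connected set with points on both sides would meet the hyperplane. The subset
  \<open>P\<close> stands for the finitely many sample points tested later.\<close>

lemma convex_one_side:
  assumes "convex A" "A \<inter> {z. c \<bullet> z = d} = {}" "P \<subseteq> A"
  shows "(\<forall>p\<in>P. d < c \<bullet> p) \<or> (\<forall>p\<in>P. c \<bullet> p < d)"
proof (rule ccontr)
  assume "\<not> ?thesis"
  then obtain p q where "p \<in> A" "q \<in> A" "c \<bullet> p \<le> d" "d \<le> c \<bullet> q"
    using assms(3) by (meson not_less subsetD)
  then obtain z where "z \<in> A" "c \<bullet> z = d"
    using connected_ivt_hyperplane[OF convex_connected[OF assms(1)], of p q c d] by blast
  then show False using assms(2) by blast
qed

section \<open>Two piercing lines in the plane, from the KKM theorem for matroids\<close>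

theorem theorem2p7:
  fixes \<F> :: "(real ^ 2) set set" and indep :: "(real ^ 2) set set \<Rightarrow> bool"
  assumes "finite \<F>"
    and "\<And>A. A \<in> \<F> \<Longrightarrow> convex A"
    and "matroid \<F> indep"
    and "matroid_rank indep \<F> = 4"
    and "\<And>\<G>. \<G> \<subseteq> \<F> \<Longrightarrow> card \<G> = 4 \<Longrightarrow> matroid_rank indep \<G> = 4
           \<Longrightarrow> \<exists>L. line L \<and> pierces L \<G>"
  shows "\<exists>L\<^sub>1 L\<^sub>2 \<F>'. line L\<^sub>1 \<and> line L\<^sub>2 \<and> L\<^sub>1 \<noteq> L\<^sub>2 \<and> \<F>' \<subseteq> \<F>
           \<and> pierces (L\<^sub>1 \<union> L\<^sub>2) \<F>' \<and> matroid_rank indep (\<F> - \<F>') \<le> 3"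
proof (rule ccontr)
  assume no: "\<not> ?thesis"
  interpret matroid \<F> indep by fact
  \<comment> \<open>If no two lines suffice, the members missed by any two lines keep full rank and
    contain a basis.\<close>
  have unpierced: "\<exists>B. indep B \<and> card B = 4 \<and> (\<forall>A\<in>B. A \<inter> L\<^sub>1 = {} \<and> A \<inter> L\<^sub>2 = {})"
    if L: "line L\<^sub>1" "line L\<^sub>2" for L\<^sub>1 L\<^sub>2
  proof -
    \<comment> \<open>The two chords may span the same line, whereas \<open>no\<close> speaks about distinct lines.\<close>
    obtain L where L': "line L" "L \<noteq> L\<^sub>1" "L\<^sub>2 \<subseteq> L\<^sub>1 \<union> L"
      using L other_line[of L\<^sub>1] by (cases "L\<^sub>1 = L\<^sub>2") auto
    define \<F>' where "\<F>' = {A \<in> \<F>. (L\<^sub>1 \<union> L) \<inter> A \<noteq> {}}"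
    have "\<not> matroid_rank indep (\<F> - \<F>') \<le> 3"
    proof
      assume "matroid_rank indep (\<F> - \<F>') \<le> 3"
      moreover have "pierces (L\<^sub>1 \<union> L) \<F>'" "\<F>' \<subseteq> \<F>" by (auto simp: pierces_def \<F>'_def)
      ultimately show False using no L(1) L'(1,2) by metis
    qed
    moreover have "matroid_rank indep (\<F> - \<F>') \<le> 4" using rank_mono[of "\<F> - \<F>'" \<F>] assms(4) by auto
    ultimately have r4: "matroid_rank indep (\<F> - \<F>') = 4" by linarith
    obtain B where "B \<subseteq> \<F> - \<F>'" "indep B" "card B = matroid_rank indep (\<F> - \<F>')"
      by (rule rank_attained)
    then show ?thesis using r4 L'(3) by (intro exI[of _ B]) (auto simp: \<F>'_def)
  qed
  define \<B> where "\<B> = {B. indep B \<and> card B = 4}"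
  have fin\<B>: "finite \<B>"
    by (rule finite_subset[OF _ finite_indep_sets[of \<F>]]) (use indep_subset_ground in \<open>auto simp: \<B>_def\<close>)
  have "\<forall>B\<in>\<B>. \<exists>L. line L \<and> pierces L B"
    using assms(5) indep_subset_ground rank_indep by (auto simp: \<B>_def)
  then obtain m where m: "\<And>B. B \<in> \<B> \<Longrightarrow> line (m B) \<and> pierces (m B) B" by metis
  then have "\<forall>B\<in>\<B>. \<forall>A\<in>B. \<exists>p. p \<in> m B \<and> p \<in> A" by (fastforce simp: pierces_def)
  then obtain q where q: "\<And>B A. B \<in> \<B> \<Longrightarrow> A \<in> B \<Longrightarrow> q B A \<in> m B \<and> q B A \<in> A" by metis
  \<comment> \<open>Replacing each set by finitely many of its points on the transversals makes compactness
    assumptions unnecessary.\<close>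
  define P where "P A = (\<lambda>B. q B A) ` {B \<in> \<B>. A \<in> B}" for A
  have finP: "finite (P A)" for A using fin\<B> by (simp add: P_def)
  have PA: "P A \<subseteq> A" for A using q by (auto simp: P_def)
  have "finite (\<Union>(P ` \<F>))" using assms(1) finP by blast
  \<comment> \<open>The circle encloses every sample point strictly, as
    \<open>quadrant_depth_face\<close> requires.\<close>
  then obtain \<rho> where \<rho>: "\<And>A p. A \<in> \<F> \<Longrightarrow> p \<in> P A \<Longrightarrow> norm p < \<rho>"
    using finite_imp_bounded bounded_pos_less by (metis UN_I)
  \<comment> \<open>One continuous weight encodes that all sample points of \<open>A\<close> lie in
    quadrant \<open>i\<close>.\<close>
  define w where "w i A x = (\<Prod>p\<in>P A. max 0 (quadrant_depth \<rho> i x p))" for i A x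
  have w_pos: "0 < w i A x \<longleftrightarrow> (\<forall>p\<in>P A. 0 < quadrant_depth \<rho> i x p)" for i A x
  proof
    assume "0 < w i A x"
    then have "max 0 (quadrant_depth \<rho> i x p) \<noteq> 0" if "p \<in> P A" for p
      using that finP unfolding w_def by (metis less_irrefl prod_zero)
    then show "\<forall>p\<in>P A. 0 < quadrant_depth \<rho> i x p" by (metis linorder_not_le max.absorb1)
  qed (auto simp: w_def intro!: prod_pos)
  obtain x f where x: "x \<in> std_simplex" and f: "inj f" "indep (range f)" "\<And>i. 0 < w i (f i) x"
  proof (rule matroid_kkm[of w])
    show "continuous_on std_simplex (w i A)" for i A
      unfolding w_def by (intro continuous_intros continuous_on_quadrant_depth)
    show "0 \<le> w i A x" for i A x by (auto simp: w_def intro: prod_nonneg)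
    show "w i A x = 0" if "x \<in> std_simplex" "x $ i = 0" and A_indep: "indep {A}" for i A x
    proof -
      have A: "A \<in> \<F>" using A_indep indep_subset_ground by blast
      \<comment> \<open>A basis through \<open>A\<close> makes \<open>P A\<close> nonempty, so the
        product has a vanishing factor.\<close>
      obtain B where "{A} \<subseteq> B" "indep B" "card B = matroid_rank indep \<F>"
        by (rule indep_extend[OF A_indep indep_subset_ground[OF A_indep]])
      then have "q B A \<in> P A" using assms(4) by (auto simp: P_def \<B>_def)
      moreover from this have "max 0 (quadrant_depth \<rho> i x (q B A)) = 0"
        using quadrant_depth_face[OF that(1,2)] \<rho>[OF A] by (simp add: max_def order_antisym)
      ultimately show ?thesis using finP by (auto simp: w_def)
    qed
    show "\<exists>B. indep B \<and> card B = CARD(4) \<and> (\<forall>A\<in>B. \<exists>i. 0 < w i A x)" for x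
    proof -
      obtain c\<^sub>1 d\<^sub>1 where 1: "c\<^sub>1 \<noteq> 0" "\<And>p. chord_side\<^sub>1 \<rho> x p = c\<^sub>1 \<bullet> p - d\<^sub>1"
        unfolding chord_side\<^sub>1_def using arc_side_affine by metis
      obtain c\<^sub>2 d\<^sub>2 where 2: "c\<^sub>2 \<noteq> 0" "\<And>p. chord_side\<^sub>2 \<rho> x p = c\<^sub>2 \<bullet> p - d\<^sub>2"
        unfolding chord_side\<^sub>2_def using arc_side_affine by metis
      \<comment> \<open>A convex member avoiding both lines has its sample points on one side of
        each, hence all in one quadrant.\<close>
      obtain B where B: "indep B" "card B = 4"
        "\<And>A. A \<in> B \<Longrightarrow> A \<inter> {z. c\<^sub>1 \<bullet> z = d\<^sub>1} = {} \<and> A \<inter> {z. c\<^sub>2 \<bullet> z = d\<^sub>2} = {}"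
        using unpierced[OF line_hyperplane[OF 1(1)] line_hyperplane[OF 2(1)]] by metis
      have "\<exists>i. 0 < w i A x" if A: "A \<in> B" for A
      proof -
        have conv: "convex A" using A B(1) assms(2) indep_subset_ground by blast
        have "(\<forall>p\<in>P A. d\<^sub>1 < c\<^sub>1 \<bullet> p) \<or> (\<forall>p\<in>P A. c\<^sub>1 \<bullet> p < d\<^sub>1)"
          "(\<forall>p\<in>P A. d\<^sub>2 < c\<^sub>2 \<bullet> p) \<or> (\<forall>p\<in>P A. c\<^sub>2 \<bullet> p < d\<^sub>2)"
          using convex_one_side[OF conv _ PA] B(3)[OF A] by auto
        then have "0 < w 1 A x \<or> 0 < w 2 A x \<or> 0 < w 3 A x \<or> 0 < w 4 A x"
          unfolding w_pos quadrant_depth_pos_iff 1(2) 2(2) by auto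
        then show ?thesis by blast
      qed
      then show ?thesis using B by auto
    qed
  qed (use that in blast)
  have B: "range f \<in> \<B>" using f(1,2) by (simp add: \<B>_def card_image)
  \<comment> \<open>\<open>z i\<close> is the sample point of \<open>f i\<close> on the transversal
    of the basis \<open>range f\<close>, so this single line meets all four quadrants.\<close>
  define z where "z i = q (range f) (f i)" for i
  have "z i \<in> P (f i)" for i using B by (auto simp: P_def z_def)
  then have z: "0 < quadrant_depth \<rho> i x (z i)" for i using f(3) w_pos by blast
  have zl: "z i \<in> m (range f)" for i using q[OF B] by (simp add: z_def)
  obtain c\<^sub>1 d\<^sub>1 where 1: "\<And>p. chord_side\<^sub>1 \<rho> x p = c\<^sub>1 \<bullet> p - d\<^sub>1"
    unfolding chord_side\<^sub>1_def using arc_side_affine by metis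
  obtain c\<^sub>2 d\<^sub>2 where 2: "\<And>p. chord_side\<^sub>2 \<rho> x p = c\<^sub>2 \<bullet> p - d\<^sub>2"
    unfolding chord_side\<^sub>2_def using arc_side_affine by metis
  show False
    using no_line_through_four_quadrants[of "m (range f)" "z 1" "z 2" "z 3" "z 4" d\<^sub>1 c\<^sub>1 c\<^sub>2 d\<^sub>2]
      m[OF B] zl z[of 1] z[of 2] z[of 3] z[of 4]
    by (simp add: quadrant_depth_pos_iff 1 2)
qed

end
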